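(* Let $(m_n)_{n\in\mathbb{N}}$ be a sequence of natural numbers such that $m_n$ divides $m_{n+1}$ for every $n$ and $m_n\to\infty$ as $n\to\infty$, and let $(X,\varphi)$ be the odometer of type $(m_n)_n$. Then there is an increasing sequence of subgroups $\Gamma_1\subset\Gamma_2\subset\cdots$ of the topological full group $[[\varphi]]$ with $[[\varphi]]=\bigcup_{n}\Gamma_n$ such that, for each $n$, $\Gamma_n$ is isomorphic to $\mathbb{Z}^{m_n}\rtimes S_{m_n}$, where the symmetric group $S_{m_n}$ acts on $\mathbb{Z}^{m_n}$ by permutations of the coordinates. In particular, any finitely generated subgroup of $[[\varphi]]$ has polynomial growth.
   Context: A Cantor set is a non-empty compact metrizable totally disconnected space without isolated points. A Cantor minimal system $(X,\varphi)$ is a Cantor set $X$ with a homeomorphism $\varphi:X\to X$ all of whose orbits $\{\varphi^n(x)\mid n\in\mathbb{Z}\}$ are dense in $X$. Topological full group: for a Cantor minimal system $(X,\varphi)$, $[[\varphi]]$ is the group (under composition) of all homeomorphisms $\psi:X\to X$ for which there exists a continuous map $c:X\to\mathbb{Z}$ such that $\psi(x)=\varphi^{c(x)}(x)$ for all $x\in X$. Odometer: write $\mathbb{Z}_m=\mathbb{Z}/m\mathbb{Z}$. Let $(m_n)_n$ be a sequence of natural numbers with $m_n\mid m_{n+1}$ and $m_n\to\infty$, and let $\rho_n:\mathbb{Z}_{m_{n+1}}\to\mathbb{Z}_{m_n}$ be the surjective homomorphism with $\rho_n(1)=1$. The odometer of type $(m_n)_n$ is the Cantor minimal system $(X,\varphi)$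 where $X=\{(x_n)_n\in\prod_n\mathbb{Z}_{m_n}\mid\rho_n(x_{n+1})=x_n \text{ for all } n\}$ with the product topology and $\varphi((x_n)_n)=(x_n+1)_n$. A finitely generated group has polynomial growth if, for some (equivalently any) finite symmetric generating set, the number of elements of word length at most $k$ is bounded above by a polynomial in $k$. *)

theory Defs
  imports "HOL-Analysis.Analysis" "HOL-Algebra.Algebra"
    "HOL-Computational_Algebra.Polynomial"
begin

text \<open>The group \<open>\<int>/m\<int>\<close> is \<^const>\<open>integer_mod_group\<close>, whose elements are the representatives
  \<open>0, ..., m - 1\<close>; in this encoding, for \<open>m n dvd m (Suc n)\<close>, the homomorphism
  \<open>\<rho>\<^sub>n\<close> with \<open>\<rho>\<^sub>n(1) = 1\<close> is reduction modulo \<open>m n\<close>.\<close>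

definition odometer_space :: "(nat \<Rightarrow> nat) \<Rightarrow> (nat \<Rightarrow> int) set" where
  "odometer_space m =
     {x. (\<forall>n. x n \<in> carrier (integer_mod_group (m n))) \<and>
         (\<forall>n. x (Suc n) mod int (m n) = x n)}"

definition odometer_topology :: "(nat \<Rightarrow> nat) \<Rightarrow> (nat \<Rightarrow> int) topology" where
  "odometer_topology m =
     subtopology
       (product_topology (\<lambda>n. discrete_topology (carrier (integer_mod_group (m n)))) UNIV)
       (odometer_space m)"

text \<open>The class of \<open>1\<close> is \<open>1 mod m n\<close>, which is \<open>0\<close> if \<open>m n = 1\<close>.\<close>

definition odometer_map :: "(nat \<Rightarrow> nat) \<Rightarrow> (nat \<Rightarrow> int) \<Rightarrow> (nat \<Rightarrow> int)" where
  "odometer_map m x = (\<lambda>n. x n \<otimes>\<^bsub>integer_mod_group (m n)\<^esub> (1 mod int (m n)))"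

text \<open>As in \<^const>\<open>BijGroup\<close>, self-maps of the space are represented by extensional functions,
  so that distinct elements of the carrier are distinct maps on the space; \<open>\<phi>\<^sup>k\<close> for an
  integer \<open>k\<close> is the power in that group.\<close>

definition topological_full_group :: "'a topology \<Rightarrow> ('a \<Rightarrow> 'a) \<Rightarrow> ('a \<Rightarrow> 'a) monoid" where
  "topological_full_group T \<phi> =
     (BijGroup (topspace T))
       \<lparr>carrier := {\<psi> \<in> Bij (topspace T). homeomorphic_map T T \<psi> \<and>
          (\<exists>c :: 'a \<Rightarrow> int. continuous_map T (discrete_topology UNIV) c \<and>
             (\<forall>x\<in>topspace T.
                \<psi> x = (restrict \<phi> (topspace T) [^]\<^bsub>BijGroup (topspace T)\<^esub> c x) x))}\<rparr>"

definition odometer_full_group :: "(nat \<Rightarrow> nat) \<Rightarrow> ((nat \<Rightarrow> int) \<Rightarrow> (nat \<Rightarrow> int)) monoid" where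
  "odometer_full_group m = topological_full_group (odometer_topology m) (odometer_map m)"

definition semidirect_product ::
  "('a, 'c) monoid_scheme \<Rightarrow> ('b, 'd) monoid_scheme \<Rightarrow> ('b \<Rightarrow> 'a \<Rightarrow> 'a) \<Rightarrow> ('a \<times> 'b) monoid" where
  "semidirect_product N H \<theta> =
     \<lparr>carrier = carrier N \<times> carrier H,
      mult = (\<lambda>(a, h) (b, k). (a \<otimes>\<^bsub>N\<^esub> \<theta> h b, h \<otimes>\<^bsub>H\<^esub> k)),
      one = (\<one>\<^bsub>N\<^esub>, \<one>\<^bsub>H\<^esub>)\<rparr>"

text \<open>The inverse makes this a left action: \<open>\<sigma>\<close> sends the \<open>i\<close>-th unit vector to the
  \<open>\<sigma>(i)\<close>-th one. Coordinates are indexed by \<open>{1..k}\<close> to match \<^const>\<open>sym_group\<close>.\<close>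

definition permute_coords :: "nat \<Rightarrow> (nat \<Rightarrow> nat) \<Rightarrow> (nat \<Rightarrow> int) \<Rightarrow> (nat \<Rightarrow> int)" where
  "permute_coords k \<sigma> v = (\<lambda>i\<in>{1..k}. v (inv_into UNIV \<sigma> i))"

definition int_semidirect_sym :: "nat \<Rightarrow> ((nat \<Rightarrow> int) \<times> (nat \<Rightarrow> nat)) monoid" where
  "int_semidirect_sym k =
     semidirect_product (product_group {1..k} (\<lambda>_. integer_group)) (sym_group k)
       (permute_coords k)"

definition finitely_generated_group :: "('a, 'b) monoid_scheme \<Rightarrow> bool" where
  "finitely_generated_group G \<longleftrightarrow>
     (\<exists>S. finite S \<and> S \<subseteq> carrier G \<and> generate G S = carrier G)"

text \<open>Only meaningful for \<open>g\<close> in the submonoid generated by \<open>S\<close>.\<close>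

definition word_length :: "('a, 'b) monoid_scheme \<Rightarrow> 'a set \<Rightarrow> 'a \<Rightarrow> nat" where
  "word_length G S g =
     (LEAST l. \<exists>w. set w \<subseteq> S \<and> length w = l \<and> foldr (mult G) w \<one>\<^bsub>G\<^esub> = g)"

definition polynomial_growth :: "('a, 'b) monoid_scheme \<Rightarrow> bool" where
  "polynomial_growth G \<longleftrightarrow>
     (\<exists>S. finite S \<and> S \<subseteq> carrier G \<and> (\<forall>s\<in>S. inv\<^bsub>G\<^esub> s \<in> S) \<and> generate G S = carrier G \<and>
        (\<exists>p :: real poly. \<forall>k :: nat.
           real (card {g \<in> carrier G. word_length G S g \<le> k}) \<le> poly p (real k)))"

end

theory Submission
  imports Defs
begin

text \<open>By compactness, the cocycle of an element of the full group is a function of a single coordinate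
  \<open>x\<^sub>n \<in> \<int>/m\<int>\<close>, where \<open>m = m\<^sub>n\<close>. The elements whose cocycle depends on \<open>x\<^sub>n\<close> only correspond to the
  bijections of \<open>\<int>\<close> commuting with translation by \<open>m\<close>: they permute the \<open>m\<close> residue classes and
  translate each of them by a multiple of \<open>m\<close>. This is the semidirect product of \<open>\<int>\<^sup>m\<close> and \<open>S\<^sub>m\<close>. A finitely
  generated subgroup lies in one of these groups, and there the vector part of a word grows at most
  linearly with its length while the permutation part takes finitely many values.\<close>

section \<open>Semidirect products and the group \<open>int_semidirect_sym k\<close>\<close>

lemma group_semidirect_product:
  assumes "group N" and "group H"
    and hom: "\<And>h. h \<in> carrier H \<Longrightarrow> \<theta> h \<in> hom N N"
    and one: "\<And>a. a \<in> carrier N \<Longrightarrow> \<theta> \<one>\<^bsub>H\<^esub> a = a"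
    and mult: "\<And>h k a. \<lbrakk>h \<in> carrier H; k \<in> carrier H; a \<in> carrier N\<rbrakk>
                 \<Longrightarrow> \<theta> (h \<otimes>\<^bsub>H\<^esub> k) a = \<theta> h (\<theta> k a)"
  shows "group (semidirect_product N H \<theta>)"
proof -
  interpret N: group N by fact
  interpret H: group H by fact
  have closed: "\<theta> h a \<in> carrier N" if "h \<in> carrier H" "a \<in> carrier N" for h a
    using hom[OF that(1)] that(2) by (auto simp: hom_def)
  have distrib: "\<theta> h (a \<otimes>\<^bsub>N\<^esub> b) = \<theta> h a \<otimes>\<^bsub>N\<^esub> \<theta> h b"
    if "h \<in> carrier H" "a \<in> carrier N" "b \<in> carrier N" for h a b
    using hom[OF that(1)] that(2,3) by (auto simp: hom_def)
  have "\<theta> h \<one>\<^bsub>N\<^esub> = \<one>\<^bsub>N\<^esub>" if "h \<in> carrier H" for h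
    using hom_one[OF hom[OF that] assms(1,1)] .
  \<comment> \<open>Left inverses suffice for \<open>groupI\<close>. The left inverse of
    \<open>(a, h)\<close> is obtained by letting the inverse of \<open>h\<close> act on the inverse
    of \<open>a\<close>.\<close>
  moreover have "\<exists>y\<in>carrier N \<times> carrier H.
      (case y of (b, k) \<Rightarrow> \<lambda>(a, h). (b \<otimes>\<^bsub>N\<^esub> \<theta> k a, k \<otimes>\<^bsub>H\<^esub> h)) (a, h) = (\<one>\<^bsub>N\<^esub>, \<one>\<^bsub>H\<^esub>)"
    if "a \<in> carrier N" "h \<in> carrier H" for a h
  proof (rule bexI)
    have "\<theta> (inv\<^bsub>H\<^esub> h) (inv\<^bsub>N\<^esub> a) \<otimes>\<^bsub>N\<^esub> \<theta> (inv\<^bsub>H\<^esub> h) a = \<one>\<^bsub>N\<^esub>"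
      using that calculation by (simp flip: distrib)
    then show "(case (\<theta> (inv\<^bsub>H\<^esub> h) (inv\<^bsub>N\<^esub> a), inv\<^bsub>H\<^esub> h) of
        (b, k) \<Rightarrow> \<lambda>(a, h). (b \<otimes>\<^bsub>N\<^esub> \<theta> k a, k \<otimes>\<^bsub>H\<^esub> h)) (a, h) = (\<one>\<^bsub>N\<^esub>, \<one>\<^bsub>H\<^esub>)"
      using that by simp
  qed (use that closed in auto)
  ultimately show ?thesis
    unfolding semidirect_product_def
    by (intro groupI) (auto simp: closed distrib one mult N.m_assoc H.m_assoc)
qed

lemma carrier_int_semidirect_sym:
  "carrier (int_semidirect_sym k) = ({1..k} \<rightarrow>\<^sub>E UNIV) \<times> {\<sigma>. \<sigma> permutes {1..k}}"
  by (auto simp: int_semidirect_sym_def semidirect_product_def sym_group_def)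

lemma mult_int_semidirect_sym:
  "(v, \<sigma>) \<otimes>\<^bsub>int_semidirect_sym k\<^esub> (w, \<tau>) =
     (\<lambda>i\<in>{1..k}. v i + permute_coords k \<sigma> w i, \<sigma> \<circ> \<tau>)"
  by (simp add: int_semidirect_sym_def semidirect_product_def sym_group_def)

lemma one_int_semidirect_sym:
  "\<one>\<^bsub>int_semidirect_sym k\<^esub> = (\<lambda>i\<in>{1..k}. 0, id)"
  by (simp add: int_semidirect_sym_def semidirect_product_def sym_group_def)

lemma group_int_semidirect_sym: "group (int_semidirect_sym k)"
  unfolding int_semidirect_sym_def
proof (rule group_semidirect_product)
  fix \<sigma> \<tau> :: "nat \<Rightarrow> nat" and v :: "nat \<Rightarrow> int"
  assume \<sigma>: "\<sigma> \<in> carrier (sym_group k)" and \<tau>: "\<tau> \<in> carrier (sym_group k)"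
    and v: "v \<in> carrier (product_group {1..k} (\<lambda>_. integer_group))"
  \<comment> \<open>Inversion reverses the composition, and precomposing \<open>v\<close> with the
    inverses reverses it again; this is why \<open>permute_coords\<close> is a left action.\<close>
  have "inv' (\<sigma> \<circ> \<tau>) = inv' \<tau> \<circ> inv' \<sigma>"
    using \<sigma> \<tau> by (simp add: sym_group_def o_inv_distrib permutes_bij)
  \<comment> \<open>The inner \<open>permute_coords\<close> is restricted to \<open>{1..k}\<close>,
    so the index at which the outer one reads it must stay in that range.\<close>
  moreover have "inv' \<sigma> i \<in> {1..k} \<longleftrightarrow> i \<in> {1..k}" for i
    using \<sigma> by (simp only: sym_group_def permutes_in_image permutes_inv partial_object.select_convs mem_Collect_eq)
  ultimately show "permute_coords k (\<sigma> \<otimes>\<^bsub>sym_group k\<^esub> \<tau>) v = permute_coords k \<sigma> (permute_coords k \<tau> v)"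
    by (auto simp: permute_coords_def sym_group_def fun_eq_iff)
next
  fix \<sigma> assume "\<sigma> \<in> carrier (sym_group k)"
  then have "inv' \<sigma> i \<in> {1..k} \<longleftrightarrow> i \<in> {1..k}" for i
    by (simp only: sym_group_def permutes_in_image permutes_inv partial_object.select_convs mem_Collect_eq)
  then show "permute_coords k \<sigma> \<in> hom (product_group {1..k} (\<lambda>_. integer_group)) (product_group {1..k} (\<lambda>_. integer_group))"
    by (auto simp: hom_def permute_coords_def fun_eq_iff)
next
  show "permute_coords k \<one>\<^bsub>sym_group k\<^esub> v = v"
    if "v \<in> carrier (product_group {1..k} (\<lambda>_. integer_group))" for v
    using that by (auto simp: permute_coords_def sym_group_def fun_eq_iff PiE_def extensional_def)
qed (simp_all add: sym_group_is_group)

section \<open>Words, word length and polynomial growth\<close>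

lemma (in group) foldr_mult_closed:
  "set w \<subseteq> carrier G \<Longrightarrow> foldr (\<otimes>) w \<one> \<in> carrier G"
  by (induction w) auto

lemma (in group) foldr_mult_append:
  "set u \<subseteq> carrier G \<Longrightarrow> set w \<subseteq> carrier G \<Longrightarrow>
     foldr (\<otimes>) (u @ w) \<one> = foldr (\<otimes>) u \<one> \<otimes> foldr (\<otimes>) w \<one>"
  by (induction u) (auto simp: m_assoc foldr_mult_closed)

text \<open>Since \<open>S\<close> is closed under inverses, an inverse of a generator is again a
  single letter, and products correspond to concatenation of words.\<close>

lemma (in group) generate_imp_word:
  assumes S: "S \<subseteq> carrier G" and inv: "\<And>s. s \<in> S \<Longrightarrow> inv s \<in> S" and "g \<in> generate G S"
  shows "\<exists>w. set w \<subseteq> S \<and> foldr (\<otimes>) w \<one> = g"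
  using assms(3)
proof induction
  case one
  show ?case by (rule exI[of _ "[]"]) simp
next
  case (incl h)
  then show ?case using S by (intro exI[of _ "[h]"]) auto
next
  case (inv h)
  then show ?case using S assms(2) by (intro exI[of _ "[inv h]"]) auto
next
  case (eng h1 h2)
  then obtain u w where "set u \<subseteq> S" "foldr (\<otimes>) u \<one> = h1" "set w \<subseteq> S" "foldr (\<otimes>) w \<one> = h2"
    by auto
  then show ?case using S by (intro exI[of _ "u @ w"]) (auto simp: foldr_mult_append simp del: foldr_append)
qed

text \<open>The \<open>LEAST\<close> in \<open>word_length\<close> is attained because at least one
  word for \<open>g\<close> exists.\<close>

lemma (in group) word_of_word_length:
  assumes "S \<subseteq> carrier G" "\<And>s. s \<in> S \<Longrightarrow> inv s \<in> S" "g \<in> generate G S"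
  shows "\<exists>w. set w \<subseteq> S \<and> length w = word_length G S g \<and> foldr (\<otimes>) w \<one> = g"
  unfolding word_length_def
  by (rule LeastI_ex) (use generate_imp_word[OF assms] in auto)

text \<open>Permuting coordinates preserves the sup norm, so the vector part of a word grows at most
  linearly with its length.\<close>

lemma foldr_int_semidirect_sym_bound:
  assumes "\<And>s i. s \<in> set w \<Longrightarrow> i \<in> {1..k} \<Longrightarrow> \<bar>fst s i\<bar> \<le> B"
    and "set w \<subseteq> carrier (int_semidirect_sym k)" and "i \<in> {1..k}"
  shows "\<bar>fst (foldr (mult (int_semidirect_sym k)) w \<one>\<^bsub>int_semidirect_sym k\<^esub>) i\<bar> \<le> B * int (length w)"
  using assms
proof (induction w arbitrary: i)
  case Nil
  then show ?case by (simp add: one_int_semidirect_sym)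
next
  case (Cons s w)
  obtain v \<sigma> where s: "s = (v, \<sigma>)" by fastforce
  obtain u \<tau> where u: "foldr (mult (int_semidirect_sym k)) w \<one>\<^bsub>int_semidirect_sym k\<^esub> = (u, \<tau>)"
    by fastforce
  have "\<sigma> permutes {1..k}"
    using Cons.prems(2) by (simp add: s carrier_int_semidirect_sym)
  \<comment> \<open>Entry \<open>i\<close> of the product reads the tail at
    \<open>inv' \<sigma> i\<close>, which is why the induction is over all coordinates at
    once.\<close>
  then have "inv' \<sigma> i \<in> {1..k}"
    using Cons.prems(3) by (simp only: permutes_in_image permutes_inv)
  then have "\<bar>u (inv' \<sigma> i)\<bar> \<le> B * int (length w)"
    using Cons.IH[of "inv' \<sigma> i"] Cons.prems u by auto
  moreover have "\<bar>v i\<bar> \<le> B"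
    using Cons.prems(1)[of s i] Cons.prems(3) by (simp add: s)
  ultimately show ?case
    using Cons.prems(3) by (simp add: s u mult_int_semidirect_sym permute_coords_def algebra_simps)
qed

lemma (in group) hom_foldr_mult:
  assumes "f \<in> hom G K" "group K" "set w \<subseteq> carrier G"
  shows "f (foldr (\<otimes>) w \<one>) = foldr (mult K) (map f w) \<one>\<^bsub>K\<^esub>"
  using assms(3)
  by (induction w) (auto simp: hom_one[OF assms(1) group_axioms assms(2)] hom_mult[OF assms(1)] foldr_mult_closed)

text \<open>The ball of radius \<open>l\<close> embeds into the product of the integer box of radius
  \<open>B * l\<close> in dimension \<open>k\<close> and the symmetric group, whose size is a
  polynomial in \<open>l\<close>.\<close>

proposition (in group) polynomial_growth_if_embeds_int_semidirect_sym:
  assumes fg: "finitely_generated_group G"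
    and hom: "f \<in> hom G (int_semidirect_sym k)" and inj: "inj_on f (carrier G)"
  shows "polynomial_growth G"
proof -
  obtain S0 where S0: "finite S0" "S0 \<subseteq> carrier G" "generate G S0 = carrier G"
    using fg by (auto simp: finitely_generated_group_def)
  \<comment> \<open>Polynomial growth asks for a symmetric generating set, so the inverses are
    added.\<close>
  define S where "S = S0 \<union> m_inv G ` S0"
  have S: "finite S" "S \<subseteq> carrier G" "\<And>s. s \<in> S \<Longrightarrow> inv s \<in> S"
    using S0(1,2) by (auto simp: S_def)
  have gen: "generate G S = carrier G"
    using S0(3) mono_generate[of S0 S] generate_incl[OF S(2)] by (auto simp: S_def)
  \<comment> \<open>A crude bound for all vector entries of the generators; unlike a maximum, the
    sum makes sense also for empty \<open>S\<close> or \<open>k = 0\<close>, and it is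
    nonnegative.\<close>
  define B where "B = (\<Sum>s\<in>S. \<Sum>i\<in>{1..k}. \<bar>fst (f s) i\<bar>)"
  have B: "\<bar>fst (f s) i\<bar> \<le> B" if "s \<in> S" "i \<in> {1..k}" for s i
  proof -
    have "\<bar>fst (f s) i\<bar> \<le> (\<Sum>i\<in>{1..k}. \<bar>fst (f s) i\<bar>)"
      using that by (intro member_le_sum) auto
    moreover have "\<dots> \<le> B"
      unfolding B_def using that S(1) by (intro member_le_sum) (auto intro: sum_nonneg)
    ultimately show ?thesis by linarith
  qed
  have "0 \<le> B" by (auto simp: B_def intro!: sum_nonneg)
  have closed: "f g \<in> carrier (int_semidirect_sym k)" if "g \<in> carrier G" for g
    using hom that by (auto simp: hom_def)
  \<comment> \<open>Each of the \<open>k\<close> coordinates takes \<open>2 * B * l + 1\<close>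
    values, and there are \<open>fact k\<close> permutations.\<close>
  define p :: "real poly" where "p = [:fact k:] * ([:1, 2 * of_int B:] ^ k)"
  have "real (card {g \<in> carrier G. word_length G S g \<le> l}) \<le> poly p (real l)" for l
  proof -
    define A where "A = ({1..k} \<rightarrow>\<^sub>E {- (B * int l)..B * int l}) \<times> {\<sigma>. \<sigma> permutes {1..k}}"
    have "f g \<in> A" if g: "g \<in> carrier G" and l: "word_length G S g \<le> l" for g
    proof -
      obtain w where w: "set w \<subseteq> S" "length w \<le> l" "foldr (\<otimes>) w \<one> = g"
        using word_of_word_length[OF S(2,3), of g] gen g l by auto
      have "f g = foldr (mult (int_semidirect_sym k)) (map f w) \<one>\<^bsub>int_semidirect_sym k\<^esub>"
        using hom_foldr_mult[OF hom group_int_semidirect_sym] w S(2) by auto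
      moreover have "set (map f w) \<subseteq> carrier (int_semidirect_sym k)"
        using w(1) S(2) closed by auto
      moreover have "\<bar>fst t i\<bar> \<le> B" if "t \<in> set (map f w)" "i \<in> {1..k}" for t i
        using that B w(1) by (metis imageE list.set_map subsetD)
      ultimately have "\<bar>fst (f g) i\<bar> \<le> B * int (length w)" if "i \<in> {1..k}" for i
        using foldr_int_semidirect_sym_bound[of "map f w" k B i] that by simp
      moreover have "B * int (length w) \<le> B * int l"
        using w(2) \<open>0 \<le> B\<close> by (intro mult_left_mono) auto
      ultimately have "\<bar>fst (f g) i\<bar> \<le> B * int l" if "i \<in> {1..k}" for i
        using that by force
      then show ?thesis
        using closed[OF g] by (force simp: A_def carrier_int_semidirect_sym PiE_iff abs_le_iff)
    qed
    moreover have "finite A"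
      unfolding A_def by (intro finite_cartesian_product finite_PiE) (auto simp: finite_permutations)
    ultimately have "card {g \<in> carrier G. word_length G S g \<le> l} \<le> card A"
      using inj by (intro card_inj_on_le[of f]) (auto intro: inj_on_subset)
    also have "real (card A) = poly p (real l)"
      using \<open>0 \<le> B\<close> card_permutations[of "{1..k}" k]
      by (simp add: A_def card_cartesian_product card_PiE p_def poly_power)
        (simp add: algebra_simps)
    finally show ?thesis by simp
  qed
  then show ?thesis
    unfolding polynomial_growth_def using S gen by blast
qed

section \<open>The odometer space and the action of the integers on it\<close>

locale odometer =
  fixes m :: "nat \<Rightarrow> nat"
  assumes dvd_Suc: "m n dvd m (Suc n)"
    and tendsto: "filterlim m at_top sequentially"
begin

abbreviation \<Omega> :: "(nat \<Rightarrow> int) set" where "\<Omega> \<equiv> odometer_space m"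
abbreviation T :: "(nat \<Rightarrow> int) topology" where "T \<equiv> odometer_topology m"

lemma dvd_le: "i \<le> n \<Longrightarrow> m i dvd m n"
  by (induction rule: dec_induct) (auto intro: dvd_trans dvd_Suc)

lemma unbounded: "\<exists>n. N \<le> m n"
  using tendsto by (auto simp: filterlim_at_top eventually_sequentially)

text \<open>Zero divides only zero, so a zero term would force all later terms to vanish, against
  divergence.\<close>

lemma pos: "0 < m n"
proof (rule ccontr)
  assume "\<not> 0 < m n"
  obtain N where N: "m k \<ge> 1" if "k \<ge> N" for k
    using tendsto by (auto simp: filterlim_at_top eventually_sequentially)
  show False
    using dvd_le[of n "max n N"] N[of "max n N"] \<open>\<not> 0 < m n\<close> by auto
qed

lemma mem_space_iff:
  "x \<in> \<Omega> \<longleftrightarrow> (\<forall>n. 0 \<le> x n \<and> x n < int (m n) \<and> x (Suc n) mod int (m n) = x n)"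
  using pos by (auto simp: odometer_space_def carrier_integer_mod_group)

lemma space_range: "x \<in> \<Omega> \<Longrightarrow> 0 \<le> x n" "x \<in> \<Omega> \<Longrightarrow> x n < int (m n)"
  by (auto simp: mem_space_iff)

text \<open>Iterating the compatibility condition shows that a coordinate determines all earlier
  ones. This allows finitely many coordinates to be replaced by a single one.\<close>

lemma space_mod:
  assumes x: "x \<in> \<Omega>" and "i \<le> n"
  shows "x n mod int (m i) = x i"
  using assms(2)
proof (induction rule: dec_induct)
  case base
  show ?case using x by (simp add: space_range)
next
  case (step n)
  have "x (Suc n) mod int (m n) mod int (m i) = x (Suc n) mod int (m i)"
    using step.hyps by (simp add: dvd_le mod_mod_cancel)
  with step x show ?case by (simp add: mem_space_iff)
qed

lemma topspace [simp]: "topspace T = \<Omega>"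
  by (auto simp: odometer_topology_def odometer_space_def)

text \<open>Closed form of the integer powers of the odometer map, made extensional on
  \<open>\<Omega>\<close> so as to be an element of \<open>BijGroup \<Omega>\<close>.\<close>

definition shift :: "int \<Rightarrow> (nat \<Rightarrow> int) \<Rightarrow> nat \<Rightarrow> int"
  where "shift k = (\<lambda>x\<in>\<Omega>. \<lambda>n. (x n + k) mod int (m n))"

lemma shift_apply: "x \<in> \<Omega> \<Longrightarrow> shift k x n = (x n + k) mod int (m n)"
  by (simp add: shift_def)

lemma shift_mem:
  assumes x: "x \<in> \<Omega>"
  shows "shift k x \<in> \<Omega>"
  unfolding mem_space_iff shift_apply[OF x]
proof (intro allI conjI)
  fix n
  have "(x (Suc n) + k) mod int (m (Suc n)) mod int (m n) = (x (Suc n) + k) mod int (m n)"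
    by (simp add: dvd_Suc mod_mod_cancel)
  also have "\<dots> = (x (Suc n) mod int (m n) + k) mod int (m n)"
    by (simp add: mod_add_left_eq)
  also have "\<dots> = (x n + k) mod int (m n)"
    by (simp add: space_mod[OF x])
  finally show "(x (Suc n) + k) mod int (m (Suc n)) mod int (m n) = (x n + k) mod int (m n)" .
qed (use pos in auto)

lemma shift_shift: "x \<in> \<Omega> \<Longrightarrow> shift k (shift l x) = shift (k + l) x"
  by (rule ext) (simp add: shift_apply shift_mem mod_add_left_eq ac_simps mod_add_right_eq)

lemma shift_0: "x \<in> \<Omega> \<Longrightarrow> shift 0 x = x"
  by (rule ext) (simp add: shift_apply space_range)

text \<open>Freeness of the action: two shifts agreeing at a point are congruent modulo every
  \<open>m n\<close>, and some \<open>m n\<close> exceeds the distance of \<open>k\<close> and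
  \<open>l\<close>.\<close>

lemma shift_eqD:
  assumes "x \<in> \<Omega>" "shift k x = shift l x"
  shows "k = l"
proof -
  obtain n where n: "m n \<ge> nat (\<bar>k - l\<bar> + 1)"
    using unbounded by blast
  have "(x n + k) mod int (m n) = (x n + l) mod int (m n)"
    using assms by (metis shift_apply)
  then have "int (m n) dvd k - l"
    by (metis add_diff_cancel_left mod_eq_dvd_iff)
  with n show ?thesis
    by (smt (verit) zdvd_not_zless dvd_minus_iff nat_le_iff)
qed

lemma shift_Bij: "shift k \<in> Bij \<Omega>"
  unfolding Bij_def
proof (intro IntI CollectI bij_betw_byWitness[where f' = "shift (- k)"])
  show "shift k \<in> extensional \<Omega>" by (simp add: shift_def)
qed (auto simp: shift_shift shift_0 shift_mem)

lemma shift_hom: "shift \<in> hom integer_group (BijGroup \<Omega>)"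
proof (rule homI)
  show "shift k \<in> carrier (BijGroup \<Omega>)" for k
    by (simp add: BijGroup_def shift_Bij)
  show "shift (k \<otimes>\<^bsub>integer_group\<^esub> l) = shift k \<otimes>\<^bsub>BijGroup \<Omega>\<^esub> shift l" for k l
    by (auto simp: BijGroup_def shift_Bij compose_def fun_eq_iff shift_shift) (simp add: shift_def)
qed

text \<open>The odometer map is \<open>shift 1\<close>, and a homomorphism from the integers carries
  multiples of \<open>1\<close> to powers.\<close>

lemma odometer_map_pow: "restrict (odometer_map m) \<Omega> [^]\<^bsub>BijGroup \<Omega>\<^esub> (k::int) = shift k"
proof -
  have "restrict (odometer_map m) \<Omega> = shift 1"
    by (auto simp: odometer_map_def shift_def fun_eq_iff mod_add_right_eq)
  then show ?thesis
    using hom_int_pow[OF shift_hom _ group_integer_group group_BijGroup, of 1 k] by simp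
qed

lemma carrier_full_group:
  "carrier (odometer_full_group m) =
     {\<psi> \<in> Bij \<Omega>. homeomorphic_map T T \<psi> \<and>
        (\<exists>c. continuous_map T (discrete_topology UNIV) c \<and> (\<forall>x\<in>\<Omega>. \<psi> x = shift (c x) x))}"
  by (simp add: odometer_full_group_def topological_full_group_def odometer_map_pow)

section \<open>Compactness and continuous integer-valued functions\<close>

lemma compact_topology: "compact_space T"
proof -
  let ?P = "product_topology (\<lambda>n. discrete_topology (carrier (integer_mod_group (m n)))) UNIV"
  have proj: "continuous_map ?P (discrete_topology UNIV) (\<lambda>x. f (x n))" for n and f :: "int \<Rightarrow> int"
    using continuous_map_compose[OF continuous_map_product_projection[of n UNIV],
        of _ "discrete_topology UNIV" f]
    by (simp add: comp_def)
  \<comment> \<open>The odometer is cut out of a product of finite discrete spaces by closed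
    conditions, one for each \<open>n\<close>; Tychonoff's theorem then gives compactness.\<close>
  have "closedin ?P {x \<in> topspace ?P. x (Suc n) mod int (m n) = x n}" for n
    using proj[of "\<lambda>i. i mod int (m n)" "Suc n"] proj[of "\<lambda>i. i" n]
    by (intro closedin_continuous_maps_eq[of "discrete_topology UNIV"]) auto
  then have "closedin ?P (\<Inter>n. {x \<in> topspace ?P. x (Suc n) mod int (m n) = x n})"
    by (intro closedin_INT) auto
  moreover have "(\<Inter>n. {x \<in> topspace ?P. x (Suc n) mod int (m n) = x n}) = \<Omega>"
    by (auto simp: odometer_space_def)
  moreover have "compact_space ?P"
    using pos by (simp add: compact_space_product_topology compact_space_discrete_topology carrier_integer_mod_group)
  ultimately show ?thesis
    by (simp add: odometer_topology_def closedin_compact_space compact_space_subtopology)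
qed

lemma continuous_map_coord: "continuous_map T (discrete_topology UNIV) (\<lambda>x. f (x n))"
proof -
  have "continuous_map T (discrete_topology (carrier (integer_mod_group (m n)))) (\<lambda>x. x n)"
    unfolding odometer_topology_def
    by (intro continuous_map_from_subtopology continuous_map_product_projection) simp
  from continuous_map_compose[OF this, of "discrete_topology UNIV" f] show ?thesis
    by (simp add: comp_def)
qed

text \<open>Around each point \<open>c\<close> is constant on a cylinder given by one coordinate.
  Finitely many cylinders cover the space, and the largest of their coordinates determines
  \<open>c\<close>.\<close>

lemma continuous_map_discrete_imp_coord:
  assumes "continuous_map T (discrete_topology UNIV) c"
  shows "\<exists>n f. \<forall>x\<in>\<Omega>. c x = f (x n)"
proof -
  let ?P = "product_topology (\<lambda>n. discrete_topology (carrier (integer_mod_group (m n)))) UNIV"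
  have "\<exists>n. \<forall>y\<in>\<Omega>. y n = x n \<longrightarrow> c y = c x" if x: "x \<in> \<Omega>" for x
  proof -
    have "openin T {y \<in> \<Omega>. c y = c x}"
      using openin_continuous_map_preimage[OF assms, of "{c x}"] by simp
    then have "\<exists>S. openin ?P S \<and> {y \<in> \<Omega>. c y = c x} = S \<inter> \<Omega>"
      by (simp only: odometer_topology_def openin_subtopology)
    then obtain S where S: "openin ?P S" "{y \<in> \<Omega>. c y = c x} = S \<inter> \<Omega>"
      by blast
    then have "x \<in> S" using x by auto
    \<comment> \<open>A basic open box around \<open>x\<close> restricts only finitely many
      coordinates; \<open>n\<close> will bound their indices.\<close>
    with S(1) have "\<exists>U. finite {i. U i \<noteq> carrier (integer_mod_group (m i))} \<and>
        x \<in> PiE UNIV U \<and> PiE UNIV U \<subseteq> S"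
      unfolding openin_product_topology_alt topspace_discrete_topology
      by (metis (no_types, lifting) Collect_cong UNIV_I)
    then obtain U where U: "finite {i. U i \<noteq> carrier (integer_mod_group (m i))}"
      "x \<in> PiE UNIV U" "PiE UNIV U \<subseteq> S"
      by blast
    then obtain n where n: "i \<le> n" if "U i \<noteq> carrier (integer_mod_group (m i))" for i
      using finite_nat_set_iff_bounded_le by auto
    have "c y = c x" if y: "y \<in> \<Omega>" "y n = x n" for y
    proof -
      have "y i \<in> U i" for i
      proof (cases "i \<le> n")
        case True
        then have "y i = x i"
          using space_mod[OF x] space_mod[OF y(1)] y(2) by metis
        then show ?thesis using U(2) by auto
      next
        case False
        then show ?thesis using n y(1) by (auto simp: odometer_space_def)
      qed
      then show ?thesis using U(3) S(2) y(1) by auto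
    qed
    then show ?thesis by blast
  qed
  then obtain N where N: "c y = c x" if "x \<in> \<Omega>" "y \<in> \<Omega>" "y (N x) = x (N x)" for x y
    by metis
  define cyl where "cyl x = {y \<in> \<Omega>. y (N x) = x (N x)}" for x
  have "openin T (cyl x)" for x
    using openin_continuous_map_preimage[OF continuous_map_coord[of "\<lambda>i. i" "N x"], of "{x (N x)}"]
    by (simp add: cyl_def)
  moreover have "\<Omega> \<subseteq> \<Union>(cyl ` \<Omega>)"
    by (auto simp: cyl_def)
  ultimately obtain \<F> where "finite \<F>" "\<F> \<subseteq> cyl ` \<Omega>" "\<Omega> \<subseteq> \<Union>\<F>"
    using compact_topology[unfolded compact_space_alt topspace, rule_format, of "cyl ` \<Omega>"] by blast
  then obtain F where F: "finite F" "F \<subseteq> \<Omega>" "\<Omega> \<subseteq> \<Union>(cyl ` F)"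
    by (metis finite_subset_image)
  \<comment> \<open>Inserting \<open>0\<close> gives \<open>Max\<close> a nonempty set, whatever
    \<open>F\<close> is.\<close>
  define n where "n = Max (insert 0 (N ` F))"
  have same: "c y = c x" if x: "x \<in> \<Omega>" and y: "y \<in> \<Omega>" and "y n = x n" for x y
  proof -
    obtain z where z: "z \<in> F" "x \<in> cyl z" using F(3) x by auto
    then have "N z \<le> n" using F(1) by (auto simp: n_def)
    then have "y (N z) = x (N z)"
      using space_mod[OF x] space_mod[OF y] that(3) by metis
    then show ?thesis
      using N[of z x] N[of z y] z F(2) x y by (auto simp: cyl_def)
  qed
  \<comment> \<open>The function of the coordinate is \<open>c\<close> evaluated at an arbitrary
    point with that coordinate.\<close>
  have "c x = c (SOME y. y \<in> \<Omega> \<and> y n = x n)" if "x \<in> \<Omega>" for x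
    using someI[of "\<lambda>y. y \<in> \<Omega> \<and> y n = x n" x] that by (intro same) simp_all
  then show ?thesis
    by (intro exI[of _ n] exI[of _ "\<lambda>i. c (SOME y. y \<in> \<Omega> \<and> y n = i)"] ballI)
qed

section \<open>The action of \<open>\<int>\<^sup>m \<rtimes> S\<^sub>m\<close> on the odometer for
  \<open>m = m n\<close>\<close>

lemma ex_coord: "0 \<le> i \<Longrightarrow> i < int (m n) \<Longrightarrow> \<exists>x\<in>\<Omega>. x n = i"
  \<comment> \<open>The witness is the image of the integer \<open>i\<close> in the
    odometer.\<close>
  using pos by (intro bexI[of _ "\<lambda>k. i mod int (m k)"])
    (auto simp: mem_space_iff dvd_Suc mod_mod_cancel)

text \<open>The element \<open>(v, \<sigma>)\<close> acts on \<open>\<int>\<close> by the bijection \<open>i + m n * t \<mapsto> \<sigma> i + m n * (t + v (\<sigma> i))\<close> for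
  \<open>i \<in> {1..m n}\<close>, which commutes with translation by \<open>m n\<close>; \<^term>\<open>displacement\<close> is the amount by
  which it moves \<open>i\<close>, and coordinate value \<open>j\<close> of the odometer corresponds to \<open>i = j + 1\<close>.\<close>

definition displacement :: "nat \<Rightarrow> (nat \<Rightarrow> int) \<times> (nat \<Rightarrow> nat) \<Rightarrow> nat \<Rightarrow> int"
  where "displacement n g i = int (snd g i) - int i + int (m n) * fst g (snd g i)"

definition level_action ::
    "nat \<Rightarrow> (nat \<Rightarrow> int) \<times> (nat \<Rightarrow> nat) \<Rightarrow> (nat \<Rightarrow> int) \<Rightarrow> nat \<Rightarrow> int"
  where "level_action n g = (\<lambda>x\<in>\<Omega>. shift (displacement n g (Suc (nat (x n)))) x)"

abbreviation W :: "nat \<Rightarrow> ((nat \<Rightarrow> int) \<times> (nat \<Rightarrow> nat)) monoid"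
  where "W n \<equiv> int_semidirect_sym (m n)"

lemma level_action_apply:
  "x \<in> \<Omega> \<Longrightarrow> level_action n g x = shift (displacement n g (Suc (nat (x n)))) x"
  by (simp add: level_action_def)

lemma level_action_mem: "x \<in> \<Omega> \<Longrightarrow> level_action n g x \<in> \<Omega>"
  by (simp add: level_action_apply shift_mem)

lemma index_mem: "x \<in> \<Omega> \<Longrightarrow> Suc (nat (x n)) \<in> {1..m n}"
  using space_range[of x n] by auto

lemma perm_mem: "g \<in> carrier (W n) \<Longrightarrow> i \<in> {1..m n} \<Longrightarrow> snd g i \<in> {1..m n}"
  using permutes_in_image by (fastforce simp: carrier_int_semidirect_sym)

text \<open>The vector part contributes multiples of \<open>m n\<close>, which vanish in coordinate
  \<open>n\<close>; only the permutation is visible there.\<close>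

lemma level_action_index:
  assumes "g \<in> carrier (W n)" "x \<in> \<Omega>"
  shows "Suc (nat (level_action n g x n)) = snd g (Suc (nat (x n)))"
proof -
  let ?i = "Suc (nat (x n))"
  have i: "snd g ?i \<in> {1..m n}"
    using assms by (intro perm_mem index_mem)
  have "x n + displacement n g ?i = int (snd g ?i) - 1 + int (m n) * fst g (snd g ?i)"
    using space_range[OF assms(2)] by (simp add: displacement_def)
  then have "level_action n g x n = (int (snd g ?i) - 1) mod int (m n)"
    by (simp only: level_action_apply[OF assms(2)] shift_apply[OF assms(2)] mod_mult_self2)
  \<comment> \<open>Indices start at \<open>1\<close>, so subtracting \<open>1\<close> gives a
    reduced residue.\<close>
  also have "\<dots> = int (snd g ?i) - 1"
    using i by (intro mod_pos_pos_trivial) auto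
  finally show ?thesis using i by auto
qed

text \<open>Displacements satisfy the cocycle identity: \<open>h\<close> moves index
  \<open>i\<close> to \<open>\<tau> i\<close>, where \<open>g\<close> adds its own displacement. In
  the product, \<open>w\<close> is read at
  \<open>inv' \<sigma> (\<sigma> (\<tau> i)) = \<tau> i\<close>.\<close>

lemma level_action_mult:
  assumes g: "g \<in> carrier (W n)" and h: "h \<in> carrier (W n)" and x: "x \<in> \<Omega>"
  shows "level_action n (g \<otimes>\<^bsub>W n\<^esub> h) x = level_action n g (level_action n h x)"
proof -
  obtain v \<sigma> w \<tau> where gh: "g = (v, \<sigma>)" "h = (w, \<tau>)"
    by fastforce
  define i where "i = Suc (nat (x n))"
  have \<sigma>: "\<sigma> permutes {1..m n}" using g by (simp add: gh carrier_int_semidirect_sym)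
  have "\<tau> i \<in> {1..m n}"
    unfolding i_def using perm_mem[OF h index_mem[OF x]] by (simp add: gh)
  moreover from this have "\<sigma> (\<tau> i) \<in> {1..m n}"
    using perm_mem[OF g] by (simp add: gh)
  ultimately have "displacement n (g \<otimes>\<^bsub>W n\<^esub> h) i = displacement n g (\<tau> i) + displacement n h i"
    using permutes_inverses(2)[OF \<sigma>]
    by (simp add: gh displacement_def mult_int_semidirect_sym permute_coords_def algebra_simps)
  then show ?thesis
    using level_action_index[OF h x]
    by (simp add: level_action_apply level_action_mem x shift_mem shift_shift gh flip: i_def)
qed

lemma level_action_one: "x \<in> \<Omega> \<Longrightarrow> level_action n \<one>\<^bsub>W n\<^esub> x = x"
  using index_mem[of x n]
  by (simp add: level_action_apply displacement_def one_int_semidirect_sym shift_0)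

lemma level_action_inverse:
  assumes "g \<in> carrier (W n)" "x \<in> \<Omega>"
  shows "level_action n (inv\<^bsub>W n\<^esub> g) (level_action n g x) = x"
    and "level_action n g (level_action n (inv\<^bsub>W n\<^esub> g) x) = x"
proof -
  interpret group "W n" by (rule group_int_semidirect_sym)
  show "level_action n (inv\<^bsub>W n\<^esub> g) (level_action n g x) = x"
    "level_action n g (level_action n (inv\<^bsub>W n\<^esub> g) x) = x"
    using assms by (simp_all add: level_action_one flip: level_action_mult)
qed

lemma level_action_Bij:
  assumes "g \<in> carrier (W n)"
  shows "level_action n g \<in> Bij \<Omega>"
  unfolding Bij_def
proof (intro IntI CollectI bij_betw_byWitness[where f' = "level_action n (inv\<^bsub>W n\<^esub> g)"])
  show "level_action n g \<in> extensional \<Omega>" by (simp add: level_action_def)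
qed (use assms in \<open>auto simp: level_action_inverse level_action_mem\<close>)

lemma level_action_hom: "level_action n \<in> hom (W n) (BijGroup \<Omega>)"
proof (rule homI)
  show "level_action n g \<in> carrier (BijGroup \<Omega>)" if "g \<in> carrier (W n)" for g
    using that by (simp add: BijGroup_def level_action_Bij)
  show "level_action n (g \<otimes>\<^bsub>W n\<^esub> h) = level_action n g \<otimes>\<^bsub>BijGroup \<Omega>\<^esub> level_action n h"
    if gh: "g \<in> carrier (W n)" "h \<in> carrier (W n)" for g h
  proof
    fix x
    show "level_action n (g \<otimes>\<^bsub>W n\<^esub> h) x = (level_action n g \<otimes>\<^bsub>BijGroup \<Omega>\<^esub> level_action n h) x"
      using level_action_mult[OF gh, of x]
      by (cases "x \<in> \<Omega>") (simp_all add: gh BijGroup_def level_action_Bij compose_def, simp add: level_action_def)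
  qed
qed

text \<open>A point with \<open>n\<close>-th coordinate \<open>i - 1\<close> reveals
  \<open>\<sigma> i\<close> through the coordinate of its image. By freeness it also reveals the
  displacement, hence the vector entry at \<open>\<sigma> i\<close>.\<close>

lemma level_action_inj: "inj_on (level_action n) (carrier (W n))"
proof (rule inj_onI)
  fix g h
  assume g: "g \<in> carrier (W n)" and h: "h \<in> carrier (W n)" and eq: "level_action n g = level_action n h"
  obtain v \<sigma> w \<tau> where gh: "g = (v, \<sigma>)" "h = (w, \<tau>)"
    by fastforce
  have *: "\<sigma> i = \<tau> i \<and> v (\<sigma> i) = w (\<sigma> i)" if i: "i \<in> {1..m n}" for i
  proof -
    obtain x where x: "x \<in> \<Omega>" "x n = int i - 1"
      using ex_coord[of "int i - 1" n] i by auto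
    then have index: "Suc (nat (x n)) = i" using i by auto
    have \<sigma>\<tau>: "\<sigma> i = \<tau> i"
      using level_action_index[OF g x(1)] level_action_index[OF h x(1)]
      unfolding index eq by (simp add: gh)
    have "displacement n g i = displacement n h i"
      using x(1) index level_action_apply[OF x(1), of n] eq by (metis shift_eqD)
    then show ?thesis
      using pos[of n] by (simp add: displacement_def gh \<sigma>\<tau>)
  qed
  have perm: "\<sigma> permutes {1..m n}" "\<tau> permutes {1..m n}"
    and ext: "v \<in> extensional {1..m n}" "w \<in> extensional {1..m n}"
    using g h by (auto simp: gh carrier_int_semidirect_sym PiE_def)
  have "\<sigma> i = \<tau> i" for i
    using * perm by (cases "i \<in> {1..m n}") (auto simp: permutes_not_in)
  \<comment> \<open>Entries are known at the indices \<open>\<sigma> i\<close> only; as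
    \<open>\<sigma>\<close> is onto, these are all of them.\<close>
  moreover have "v i = w i" if "i \<in> {1..m n}" for i
    using *[of "inv' \<sigma> i"] that perm(1)
    by (metis permutes_in_image permutes_inv permutes_inverses(1))
  then have "v = w" using ext by (intro extensionalityI)
  ultimately show "g = h" by (auto simp: gh)
qed

text \<open>Division with remainder by \<open>m n\<close> splits the integer map induced by
  \<open>C\<close> on representatives: remainders give the permutation, quotients the
  vector.\<close>

lemma level_action_surj:
  assumes \<psi>: "\<psi> \<in> Bij \<Omega>" and C: "\<And>x. x \<in> \<Omega> \<Longrightarrow> \<psi> x = shift (C (x n)) x"
  shows "\<psi> \<in> level_action n ` carrier (W n)"
proof -
  define M where "M = int (m n)"
  \<comment> \<open>\<open>F i\<close> is where the representative \<open>i - 1\<close> of the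
    \<open>i\<close>-th class is sent; \<open>q i\<close> is the class of \<open>F i\<close>, again
    numbered from \<open>1\<close>.\<close>
  define F where "F i = int i - 1 + C (int i - 1)" for i
  define q where "q i = Suc (nat (F i mod M))" for i
  have "0 < M" using pos by (simp add: M_def)
  have q: "int (q i) - 1 = F i mod M" for i
    using \<open>0 < M\<close> by (simp add: q_def)
  have "q i \<in> {1..m n}" for i
  proof -
    have "q i \<le> m n"
      using pos_mod_bound[OF \<open>0 < M\<close>, of "F i"] q[of i] M_def by linarith
    then show ?thesis by (simp add: q_def)
  qed
  \<comment> \<open>Surjectivity of \<open>\<psi>\<close> passes to residue classes: a preimage of a
    point in class \<open>j\<close> lies in a class that \<open>q\<close> sends to \<open>j\<close>.
    On a finite set this makes \<open>q\<close> bijective.\<close>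
  moreover have "j \<in> q ` {1..m n}" if j: "j \<in> {1..m n}" for j
  proof -
    obtain y where y: "y \<in> \<Omega>" "y n = int j - 1"
      using ex_coord[of "int j - 1" n] j by auto
    have "\<psi> ` \<Omega> = \<Omega>"
      using \<psi> by (simp add: Bij_def bij_betw_def)
    with y(1) obtain x where x: "x \<in> \<Omega>" "\<psi> x = y"
      by (metis imageE)
    let ?i = "Suc (nat (x n))"
    have "int j - 1 = (x n + C (x n)) mod M"
      using C[OF x(1)] x y(2) by (simp add: shift_apply M_def)
    also have "\<dots> = int (q ?i) - 1"
      using space_range[OF x(1)] by (simp add: q F_def)
    finally have "q ?i = j" by simp
    with index_mem[OF x(1)] show ?thesis by blast
  qed
  ultimately have "q ` {1..m n} = {1..m n}" by blast
  then have "bij_betw q {1..m n} {1..m n}"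
    by (simp add: bij_betw_def eq_card_imp_inj_on)
  then have perm: "(\<lambda>i. if i \<in> {1..m n} then q i else i) permutes {1..m n}" (is "?\<sigma> permutes _")
    by (rule bij_imp_permutes[OF bij_betw_cong[THEN iffD1], rotated]) auto
  \<comment> \<open>The vector is indexed by the target class, so the quotient of the source class
    is pulled back along the inverse permutation.\<close>
  define v where "v = (\<lambda>j\<in>{1..m n}. F (inv' ?\<sigma> j) div M)"
  have g: "(v, ?\<sigma>) \<in> carrier (W n)"
    using perm by (simp add: carrier_int_semidirect_sym v_def)
  have "\<psi> x = level_action n (v, ?\<sigma>) x" for x
  proof (cases "x \<in> \<Omega>")
    case True
    let ?i = "Suc (nat (x n))"
    have i: "?i \<in> {1..m n}" by (rule index_mem[OF True])
    then have "v (q ?i) = F ?i div M"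
      using permutes_inverses(2)[OF perm, of ?i] perm_mem[OF g i] by (simp add: v_def)
    then have "displacement n (v, ?\<sigma>) ?i = F ?i mod M + 1 - int ?i + M * (F ?i div M)"
      using i q[of ?i] by (simp add: displacement_def M_def)
    also have "\<dots> = C (x n)"
    proof -
      have "int ?i = x n + 1"
        using space_range[OF True] by simp
      moreover from this have "F ?i mod M + M * (F ?i div M) = x n + C (x n)"
        by (simp add: F_def)
      ultimately show ?thesis by linarith
    qed
    finally show ?thesis
      by (simp only: level_action_apply[OF True] C[OF True])
  next
    case False
    then show ?thesis
      using \<psi> by (simp add: level_action_def Bij_def extensional_def)
  qed
  then show ?thesis using g by (intro image_eqI[of _ _ "(v, ?\<sigma>)"]) auto
qed

text \<open>Coordinate \<open>k\<close> of the image depends on coordinates \<open>n\<close> and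
  \<open>k\<close> of the point only, and both are reductions of coordinate \<open>max n k\<close>.
  So it is a map of discrete spaces after a projection.\<close>

lemma level_action_continuous: "continuous_map T T (level_action n g)"
proof -
  let ?D = "\<lambda>n. discrete_topology (carrier (integer_mod_group (m n)))"
  have "continuous_map T (?D k) (\<lambda>x. level_action n g x k)" for k
  proof -
    let ?l = "max n k"
    define f where "f i = (i mod int (m k) + displacement n g (Suc (nat (i mod int (m n))))) mod int (m k)" for i
    have "continuous_map T (?D k) (\<lambda>x. f (x ?l))"
    proof -
      have "continuous_map T (?D ?l) (\<lambda>x. x ?l)"
        unfolding odometer_topology_def
        by (intro continuous_map_from_subtopology continuous_map_product_projection) simp
      moreover have "continuous_map (?D ?l) (?D k) f"
        using pos by (simp add: f_def carrier_integer_mod_group)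
      ultimately have "continuous_map T (?D k) (f \<circ> (\<lambda>x. x ?l))"
        by (rule continuous_map_compose)
      then show ?thesis by (simp add: comp_def)
    qed
    moreover have "f (x ?l) = level_action n g x k" if "x \<in> \<Omega>" for x
      using that by (simp add: f_def level_action_apply shift_apply space_mod)
    ultimately show ?thesis
      by (rule continuous_map_eq) simp
  qed
  then have "continuous_map T (product_topology ?D UNIV) (level_action n g)"
    by (simp add: continuous_map_componentwise_UNIV)
  then show ?thesis
    by (subst (2) odometer_topology_def) (auto simp: continuous_map_in_subtopology level_action_mem)
qed

text \<open>The inverse map is the action of the inverse element, hence continuous too; the cocycle
  is the displacement, a function of one coordinate.\<close>

lemma level_action_full_group:
  assumes "g \<in> carrier (W n)"
  shows "level_action n g \<in> carrier (odometer_full_group m)"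
  unfolding carrier_full_group
proof (intro CollectI conjI exI[of _ "\<lambda>x. displacement n g (Suc (nat (x n)))"])
  have "homeomorphic_maps T T (level_action n g) (level_action n (inv\<^bsub>W n\<^esub> g))"
    using assms by (simp add: homeomorphic_maps_def level_action_continuous level_action_inverse)
  then show "homeomorphic_map T T (level_action n g)"
    by (auto simp: homeomorphic_map_maps)
  show "continuous_map T (discrete_topology UNIV) (\<lambda>x. displacement n g (Suc (nat (x n))))"
    by (rule continuous_map_coord)
qed (use assms in \<open>auto simp: level_action_Bij level_action_apply\<close>)

section \<open>The increasing sequence of subgroups and its union\<close>

definition level_group :: "nat \<Rightarrow> ((nat \<Rightarrow> int) \<Rightarrow> nat \<Rightarrow> int) set"
  where "level_group n = level_action n ` carrier (W n)"

text \<open>This description by cocycles makes different levels comparable, which the images of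
  different semidirect products are not at sight.\<close>

lemma level_group_iff:
  "\<psi> \<in> level_group n \<longleftrightarrow> \<psi> \<in> Bij \<Omega> \<and> (\<exists>C. \<forall>x\<in>\<Omega>. \<psi> x = shift (C (x n)) x)"
proof (intro iffI conjI)
  assume "\<psi> \<in> level_group n"
  then obtain g where g: "g \<in> carrier (W n)" "\<psi> = level_action n g"
    by (auto simp: level_group_def)
  then show "\<psi> \<in> Bij \<Omega>" by (simp add: level_action_Bij)
  show "\<exists>C. \<forall>x\<in>\<Omega>. \<psi> x = shift (C (x n)) x"
    by (rule exI[of _ "\<lambda>i. displacement n g (Suc (nat i))"]) (simp add: g level_action_apply)
qed (auto simp: level_group_def intro: level_action_surj)

text \<open>A function of coordinate \<open>i\<close> is a function of coordinate \<open>n\<close>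
  composed with reduction modulo \<open>m i\<close>.\<close>

lemma level_group_mono: "i \<le> n \<Longrightarrow> level_group i \<subseteq> level_group n"
proof
  fix \<psi>
  assume "i \<le> n" "\<psi> \<in> level_group i"
  then obtain C where "\<psi> \<in> Bij \<Omega>" and C: "\<And>x. x \<in> \<Omega> \<Longrightarrow> \<psi> x = shift (C (x i)) x"
    by (auto simp: level_group_iff)
  moreover have "\<psi> x = shift (C (x n mod int (m i))) x" if "x \<in> \<Omega>" for x
    using C[OF that] space_mod[OF that \<open>i \<le> n\<close>] by simp
  ultimately show "\<psi> \<in> level_group n"
    unfolding level_group_iff by (intro conjI exI[of _ "\<lambda>j. C (j mod int (m i))"]) auto
qed

lemma full_group_eq_Union: "carrier (odometer_full_group m) = (\<Union>n. level_group n)"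
proof
  show "carrier (odometer_full_group m) \<subseteq> (\<Union>n. level_group n)"
  proof
    fix \<psi>
    assume "\<psi> \<in> carrier (odometer_full_group m)"
    then obtain c where \<psi>: "\<psi> \<in> Bij \<Omega>" and cont: "continuous_map T (discrete_topology UNIV) c"
      and c: "\<And>x. x \<in> \<Omega> \<Longrightarrow> \<psi> x = shift (c x) x"
      by (auto simp: carrier_full_group)
    obtain n f where f: "\<forall>x\<in>\<Omega>. c x = f (x n)"
      using continuous_map_discrete_imp_coord[OF cont] by blast
    have "\<psi> \<in> level_group n"
      unfolding level_group_iff using \<psi> c f by (intro conjI exI[of _ f]) auto
    then show "\<psi> \<in> (\<Union>n. level_group n)" by blast
  qed
qed (auto simp: level_group_def level_action_full_group)

text \<open>Both structures share their operations, so subgroup facts can be moved between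
  \<open>BijGroup \<Omega>\<close> and the full group.\<close>

lemma full_group_restrict [simp]:
  "(odometer_full_group m)\<lparr>carrier := H\<rparr> = (BijGroup \<Omega>)\<lparr>carrier := H\<rparr>"
  by (simp add: odometer_full_group_def topological_full_group_def)

lemma subgroup_level_group_Bij: "subgroup (level_group n) (BijGroup \<Omega>)"
proof -
  interpret group_hom "W n" "BijGroup \<Omega>" "level_action n"
    by (intro group_hom.intro group_hom_axioms.intro group_int_semidirect_sym group_BijGroup level_action_hom)
  show ?thesis unfolding level_group_def by (rule img_is_subgroup)
qed

text \<open>The group laws come from a directed union of subgroups of
  \<open>BijGroup \<Omega>\<close>, rather than from composing and inverting cocycles: any two
  elements lie in a common level.\<close>

lemma group_full_group: "group (odometer_full_group m)"
proof -
  interpret B: group "BijGroup \<Omega>" by (rule group_BijGroup)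
  have *: "\<exists>n. \<psi> \<in> level_group n \<and> \<xi> \<in> level_group n" if "\<psi> \<in> level_group i" "\<xi> \<in> level_group j" for \<psi> \<xi> i j
    using that level_group_mono[of i "max i j"] level_group_mono[of j "max i j"] by auto
  have "subgroup (\<Union>n. level_group n) (BijGroup \<Omega>)"
  proof (rule B.subgroupI)
    show "(\<Union>n. level_group n) \<subseteq> carrier (BijGroup \<Omega>)"
      using subgroup.subset[OF subgroup_level_group_Bij] by blast
    show "(\<Union>n. level_group n) \<noteq> {}"
      using subgroup.one_closed[OF subgroup_level_group_Bij] by blast
    show "inv\<^bsub>BijGroup \<Omega>\<^esub> \<psi> \<in> (\<Union>n. level_group n)" if "\<psi> \<in> (\<Union>n. level_group n)" for \<psi>
      using that subgroup.m_inv_closed[OF subgroup_level_group_Bij] by blast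
    show "\<psi> \<otimes>\<^bsub>BijGroup \<Omega>\<^esub> \<xi> \<in> (\<Union>n. level_group n)"
      if "\<psi> \<in> (\<Union>n. level_group n)" "\<xi> \<in> (\<Union>n. level_group n)" for \<psi> \<xi>
    proof -
      from that obtain i j where "\<psi> \<in> level_group i" "\<xi> \<in> level_group j" by blast
      from *[OF this] obtain n where "\<psi> \<in> level_group n" "\<xi> \<in> level_group n" by blast
      then show ?thesis
        using subgroup.m_closed[OF subgroup_level_group_Bij] by blast
    qed
  qed
  then have "group ((BijGroup \<Omega>)\<lparr>carrier := carrier (odometer_full_group m)\<rparr>)"
    unfolding full_group_eq_Union by (rule B.subgroup_imp_group)
  moreover have "(BijGroup \<Omega>)\<lparr>carrier := carrier (odometer_full_group m)\<rparr> = odometer_full_group m"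
    by (simp add: odometer_full_group_def topological_full_group_def)
  ultimately show ?thesis by simp
qed

lemma subgroup_level_group: "subgroup (level_group n) (odometer_full_group m)"
proof -
  have "group ((odometer_full_group m)\<lparr>carrier := level_group n\<rparr>)"
    using group.subgroup_imp_group[OF group_BijGroup subgroup_level_group_Bij] by simp
  then show ?thesis
    by (intro group.group_incl_imp_subgroup[OF group_full_group]) (auto simp: full_group_eq_Union)
qed

lemma level_action_iso: "level_action n \<in> iso (W n) ((odometer_full_group m)\<lparr>carrier := level_group n\<rparr>)"
  using level_action_hom level_action_inj
  by (auto simp: iso_def hom_def bij_betw_def level_group_def)

section \<open>Growth of finitely generated subgroups\<close>

lemma finite_subset_level_group:
  assumes "finite S" "S \<subseteq> carrier (odometer_full_group m)"
  shows "\<exists>n. S \<subseteq> level_group n"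
  using assms
proof (induction S)
  case (insert \<psi> S)
  then obtain i j where "\<psi> \<in> level_group i" "S \<subseteq> level_group j"
    by (auto simp: full_group_eq_Union)
  then show ?case
    using level_group_mono[of i "max i j"] level_group_mono[of j "max i j"]
    by (intro exI[of _ "max i j"]) auto
qed simp

lemma fg_subgroup_polynomial_growth:
  assumes H: "subgroup H (odometer_full_group m)"
    and fg: "finitely_generated_group ((odometer_full_group m)\<lparr>carrier := H\<rparr>)"
  shows "polynomial_growth ((odometer_full_group m)\<lparr>carrier := H\<rparr>)"
proof -
  let ?G = "odometer_full_group m"
  interpret group ?G by (rule group_full_group)
  obtain S where S: "finite S" "S \<subseteq> H" "generate (?G\<lparr>carrier := H\<rparr>) S = H"
    using fg by (auto simp: finitely_generated_group_def)
  obtain n where n: "S \<subseteq> level_group n"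
    using finite_subset_level_group[OF S(1)] S(2) subgroup.subset[OF H] by blast
  \<comment> \<open>Generating inside \<open>H\<close> or inside the full group gives the same set,
    so a level containing the generators contains \<open>H\<close>.\<close>
  then have HL: "H \<subseteq> level_group n"
    using generate_subgroup_incl[OF n subgroup_level_group] S(3) generate_consistent[OF S(2) H] by simp
  \<comment> \<open>The inverse of the isomorphism \<open>level_action n\<close>, restricted to
    \<open>H\<close>, is the embedding that the growth bound requires.\<close>
  let ?f = "inv_into (carrier (W n)) (level_action n)"
  have f: "?f \<in> iso (?G\<lparr>carrier := level_group n\<rparr>) (W n)"
    by (rule group.iso_set_sym[OF group_int_semidirect_sym level_action_iso])
  show ?thesis
  proof (rule group.polynomial_growth_if_embeds_int_semidirect_sym[OF _ fg])
    show "group (?G\<lparr>carrier := H\<rparr>)" by (rule subgroup_imp_group[OF H])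
    show "?f \<in> hom (?G\<lparr>carrier := H\<rparr>) (W n)"
      using f HL by (auto simp: iso_def hom_def)
    show "inj_on ?f (carrier (?G\<lparr>carrier := H\<rparr>))"
      using f HL by (auto simp: iso_def bij_betw_def intro: inj_on_subset)
  qed
qed

end

theorem proposition2p1:
  fixes m :: "nat \<Rightarrow> nat"
  assumes "\<And>n. m n dvd m (Suc n)"
    and "filterlim m at_top sequentially"
  shows "(\<exists>\<Gamma> :: nat \<Rightarrow> ((nat \<Rightarrow> int) \<Rightarrow> (nat \<Rightarrow> int)) set.
            (\<forall>n. subgroup (\<Gamma> n) (odometer_full_group m)) \<and>
            (\<forall>n. \<Gamma> n \<subseteq> \<Gamma> (Suc n)) \<and>
            carrier (odometer_full_group m) = (\<Union>n. \<Gamma> n) \<and>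
            (\<forall>n. (odometer_full_group m)\<lparr>carrier := \<Gamma> n\<rparr> \<cong> int_semidirect_sym (m n)))
       \<and> (\<forall>H. subgroup H (odometer_full_group m) \<and> finitely_generated_group ((odometer_full_group m)\<lparr>carrier := H\<rparr>) \<longrightarrow>
            polynomial_growth ((odometer_full_group m)\<lparr>carrier := H\<rparr>))"
proof -
  interpret odometer m
    using assms by unfold_locales
  have "(odometer_full_group m)\<lparr>carrier := level_group n\<rparr> \<cong> int_semidirect_sym (m n)" for n
    using group.iso_sym[OF group_int_semidirect_sym] level_action_iso unfolding is_iso_def by blast
  then show ?thesis
    using subgroup_level_group level_group_mono full_group_eq_Union fg_subgroup_polynomial_growth
    by (intro conjI exI[of _ level_group]) auto
qed

end
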